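(* Let $B$ be a non-trivial Boolean algebra. If $\mathcal C$ is a descending chain (with respect to inclusion) of ultracontacts on $B$, then $\bigcap\mathcal C$ is an ultracontact on $B$; that is, the meet of $\mathcal C$ in the lattice $\mathrm{UC}(B)$ equals $\bigcap\mathcal C$.
   Context: Let $B$ be a non-trivial Boolean algebra with order $\le$ and join $+$. For $F,G\subseteq B$ put $F+G=\{f+g: f\in F,\ g\in G\}$, and write $F\preceq G$ iff for every $g\in G$ there is $f\in F$ with $f\le g$. An ultracontact on $B$ is a family $\mathscr K\subseteq 2^B$ such that for all $F,G\subseteq B$: (K0) $\emptyset\notin\mathscr K$; (K1) if $0\in F$ then $F\notin\mathscr K$; (K2) if $x\neq 0$ then $\{x\}\in\mathscr K$; (K3) if $F\preceq G$, $G\neq\emptyset$ and $F\in\mathscr K$, then $G\in\mathscr K$; (K4) if $F+G\in\mathscr K$ then $F\in\mathscr K$ or $G\in\mathscr K$. $\mathrm{UC}(B)$ is the complete lattice of ultracontacts on $B$ ordered by inclusion. *)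

theory Defs
  imports "HOL-Algebra.Complete_Lattice"
begin

definition set_join :: "'a::boolean_algebra set \<Rightarrow> 'a set \<Rightarrow> 'a set"  (infixl \<open>\<oplus>\<^sub>s\<close> 65)
  where "F \<oplus>\<^sub>s G = {sup f g | f g. f \<in> F \<and> g \<in> G}"

definition coarser :: "'a::boolean_algebra set \<Rightarrow> 'a set \<Rightarrow> bool"  (infix \<open>\<preceq>\<^sub>s\<close> 50)
  where "F \<preceq>\<^sub>s G \<longleftrightarrow> (\<forall>g\<in>G. \<exists>f\<in>F. f \<le> g)"

definition ultracontact :: "'a::boolean_algebra set set \<Rightarrow> bool"
  where "ultracontact K \<longleftrightarrow>
    {} \<notin> K \<and>
    (\<forall>F. bot \<in> F \<longrightarrow> F \<notin> K) \<and>
    (\<forall>x. x \<noteq> bot \<longrightarrow> {x} \<in> K) \<and>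
    (\<forall>F G. F \<preceq>\<^sub>s G \<and> G \<noteq> {} \<and> F \<in> K \<longrightarrow> G \<in> K) \<and>
    (\<forall>F G. F \<oplus>\<^sub>s G \<in> K \<longrightarrow> F \<in> K \<or> G \<in> K)"

definition UC :: "'a::boolean_algebra set set gorder"
  where "UC = \<lparr>carrier = {K. ultracontact K}, eq = (=), le = (\<subseteq>)\<rparr>"

text \<open>
  \<open>UC\<close> is a complete lattice, so \<open>\<Sqinter>\<^bsub>UC\<^esub>\<close>, which the library defines by choice, is the
  greatest lower bound for every family of ultracontacts. Suprema of nonempty families are unions,
  and the least ultracontact consists of the nonempty sets having a nonzero lower bound.
\<close>

definition least_uc :: "'a::boolean_algebra set set"
  where "least_uc = {F. F \<noteq> {} \<and> (\<exists>x. x \<noteq> bot \<and> (\<forall>f\<in>F. x \<le> f))}"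

lemma ultracontact_least: "ultracontact (least_uc :: 'a::boolean_algebra set set)"
proof -
  let ?O = "least_uc :: 'a set set"
  have k4: "F \<in> ?O \<or> G \<in> ?O" if FG: "F \<oplus>\<^sub>s G \<in> ?O" for F G :: "'a set"
  proof -
    from FG have ne: "F \<noteq> {}" "G \<noteq> {}" by (auto simp: set_join_def least_uc_def)
    from FG obtain x where x: "x \<noteq> bot" "\<And>f g. f \<in> F \<Longrightarrow> g \<in> G \<Longrightarrow> x \<le> sup f g"
      by (auto simp: set_join_def least_uc_def)
    show ?thesis
    proof (cases "\<forall>g\<in>G. x \<le> g")
      case True
      then show ?thesis using ne x by (auto simp: least_uc_def)
    next
      case False
      then obtain g where g: "g \<in> G" "\<not> x \<le> g" by blast
      have "inf x (- g) \<noteq> bot"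
        using g by (metis inf_shunt double_compl)
      moreover have "\<forall>f\<in>F. inf x (- g) \<le> f"
      proof
        fix f assume "f \<in> F"
        then have "x \<le> sup f g" using x g by blast
        then show "inf x (- g) \<le> f" by (simp add: shunt1 sup_commute)
      qed
      ultimately show ?thesis using ne by (auto simp: least_uc_def)
    qed
  qed
  have k3: "G \<in> ?O" if "F \<preceq>\<^sub>s G" "G \<noteq> {}" "F \<in> ?O" for F G :: "'a set"
    using that unfolding coarser_def least_uc_def by (blast intro: order_trans)
  have k1: "F \<notin> ?O" if "bot \<in> F" for F :: "'a set"
    using that by (auto simp: least_uc_def le_bot)
  have k2: "{x} \<in> ?O" if "x \<noteq> bot" for x :: 'a using that by (auto simp: least_uc_def)
  show ?thesis unfolding ultracontact_def
  proof (intro conjI allI impI)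
    show "{} \<notin> ?O" by (simp add: least_uc_def)
  next
    fix F G assume "F \<preceq>\<^sub>s G \<and> G \<noteq> {} \<and> F \<in> ?O"
    then show "G \<in> ?O" using k3 by meson
  qed (fact k1 k2 k4)+
qed

lemma ultracontact_least_le:
  assumes "ultracontact (K :: 'a::boolean_algebra set set)"
  shows "least_uc \<subseteq> K"
proof
  fix F :: "'a set" assume "F \<in> least_uc"
  then obtain x where "F \<noteq> {}" "x \<noteq> bot" "{x} \<preceq>\<^sub>s F" by (auto simp: coarser_def least_uc_def)
  moreover from this assms have "{x} \<in> K" unfolding ultracontact_def by simp
  ultimately show "F \<in> K" using assms unfolding ultracontact_def by metis
qed

lemma ultracontact_Union:
  assumes A: "\<And>K. K \<in> A \<Longrightarrow> ultracontact K" and ne: "A \<noteq> {}"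
  shows "ultracontact (\<Union>A)"
  unfolding ultracontact_def
proof (intro conjI allI impI)
  show "{} \<notin> \<Union>A" using A by (auto simp: ultracontact_def)
next
  fix F :: "'a set" assume "bot \<in> F"
  then show "F \<notin> \<Union>A" using A by (auto simp: ultracontact_def)
next
  fix x :: 'a assume "x \<noteq> bot"
  then show "{x} \<in> \<Union>A" using A ne by (auto simp: ultracontact_def)
next
  fix F G assume FG: "F \<preceq>\<^sub>s G \<and> G \<noteq> {} \<and> F \<in> \<Union>A"
  then obtain K where K: "K \<in> A" "F \<in> K" by blast
  then have "G \<in> K" using FG A[OF K(1)] unfolding ultracontact_def by simp metis
  then show "G \<in> \<Union>A" using K by blast
next
  fix F G assume "F \<oplus>\<^sub>s G \<in> \<Union>A"
  then obtain K where K: "K \<in> A" "F \<oplus>\<^sub>s G \<in> K" by blast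
  then have "F \<in> K \<or> G \<in> K" using A[OF K(1)] unfolding ultracontact_def by simp
  then show "F \<in> \<Union>A \<or> G \<in> \<Union>A" using K by blast
qed

lemma UC_complete_lattice: "complete_lattice UC"
proof (rule partial_order.complete_latticeI)
  show "partial_order UC" unfolding UC_def by standard auto
next
  fix A :: "'a set set set" assume A: "A \<subseteq> carrier UC"
  then have uc: "\<And>K. K \<in> A \<Longrightarrow> ultracontact K" by (auto simp: UC_def)
  let ?S = "\<Union>(insert least_uc A)"
  have S: "ultracontact ?S"
    using uc ultracontact_least by (intro ultracontact_Union) blast+
  have "is_lub UC ?S A"
  proof (rule least_UpperI)
    show "?S \<sqsubseteq>\<^bsub>UC\<^esub> K" if "K \<in> Upper UC A" for K
    proof -
      from that have "ultracontact K" by (simp add: Upper_def UC_def)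
      moreover from that uc have "\<And>L. L \<in> A \<Longrightarrow> L \<subseteq> K" by (simp add: Upper_def UC_def)
      ultimately have "?S \<subseteq> K" using ultracontact_least_le[of K] by blast
      then show ?thesis by (simp add: UC_def)
    qed
    show "K \<sqsubseteq>\<^bsub>UC\<^esub> ?S" if "K \<in> A" for K
      using that by (simp add: UC_def) blast
    show "A \<subseteq> carrier UC" by (fact A)
    show "?S \<in> carrier UC" using S by (simp add: UC_def)
  qed
  then show "\<exists>s. is_lub UC s A" ..
next
  fix A :: "'a set set set" assume A: "A \<subseteq> carrier UC"
  then have uc: "\<And>K. K \<in> A \<Longrightarrow> ultracontact K" by (auto simp: UC_def)
  have "least_uc \<in> Lower UC A"
    by (simp add: Lower_def UC_def ultracontact_least ultracontact_least_le)
  moreover have "\<And>K. K \<in> Lower UC A \<Longrightarrow> ultracontact K" by (simp add: Lower_def UC_def)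
  ultimately have I: "ultracontact (\<Union>(Lower UC A))"
    by (intro ultracontact_Union) blast+
  have "is_glb UC (\<Union>(Lower UC A)) A"
  proof (rule greatest_LowerI)
    show "\<Union>(Lower UC A) \<sqsubseteq>\<^bsub>UC\<^esub> K" if "K \<in> A" for K
    proof -
      have "L \<subseteq> K" if "L \<in> Lower UC A" for L
        using that \<open>K \<in> A\<close> uc by (simp add: Lower_def UC_def)
      then have "\<Union>(Lower UC A) \<subseteq> K" by (rule Union_least)
      then show ?thesis by (simp add: UC_def)
    qed
    show "K \<sqsubseteq>\<^bsub>UC\<^esub> \<Union>(Lower UC A)" if "K \<in> Lower UC A" for K
    proof -
      from that have "K \<subseteq> \<Union>(Lower UC A)" by (rule Union_upper)
      then show ?thesis by (simp add: UC_def)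
    qed
    show "A \<subseteq> carrier UC" by (fact A)
    show "\<Union>(Lower UC A) \<in> carrier UC" using I by (simp add: UC_def)
  qed
  then show "\<exists>i. is_glb UC i A" ..
qed

end

theory Submission
  imports Defs
begin

text \<open>Membership conditions that speak of one ultracontact at a time survive intersection of a
  nonempty family; the delicate axiom is the disjunctive one, for
  \<open>F \<oplus>\<^sub>s G\<close>. In a chain, if one member omits F and another omits G, the
  smaller of the two omits both although it contains the join, which is absurd
  (\<open>ultracontact_Inter_chain\<close>). Once the intersection is an ultracontact, it is the
  greatest lower bound (\<open>UC_meet_eq_Inter\<close>).\<close>

lemma ultracontact_Inter_chain:
  assumes ne: "\<C> \<noteq> {}" and chain: "subset.chain {K. ultracontact K} \<C>"
  shows "ultracontact (\<Inter>\<C>)"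
proof -
  have uc: "\<And>K. K \<in> \<C> \<Longrightarrow> ultracontact K"
    and total: "\<And>K L. K \<in> \<C> \<Longrightarrow> L \<in> \<C> \<Longrightarrow> K \<subseteq> L \<or> L \<subseteq> K"
    using chain unfolding subset_chain_def by blast+
  show ?thesis
    unfolding ultracontact_def
  proof (intro conjI allI impI)
    \<comment> \<open>Exclusion from the intersection needs an actual member of the chain, since
      \<open>\<Inter>{}\<close> is everything.\<close>
    show "{} \<notin> \<Inter>\<C>" using uc ne by (auto simp: ultracontact_def)
  next
    fix F :: "'a set" assume "bot \<in> F"
    then show "F \<notin> \<Inter>\<C>" using uc ne by (auto simp: ultracontact_def)
  next
    fix x :: 'a assume "x \<noteq> bot"
    then show "{x} \<in> \<Inter>\<C>" using uc by (auto simp: ultracontact_def)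
  next
    fix F G assume FG: "F \<preceq>\<^sub>s G \<and> G \<noteq> {} \<and> F \<in> \<Inter>\<C>"
    show "G \<in> \<Inter>\<C>"
    proof
      fix K assume "K \<in> \<C>"
      then show "G \<in> K" using FG uc[of K] unfolding ultracontact_def by simp metis
    qed
  next
    fix F G assume FG: "F \<oplus>\<^sub>s G \<in> \<Inter>\<C>"
    show "F \<in> \<Inter>\<C> \<or> G \<in> \<Inter>\<C>"
    proof (rule ccontr)
      assume "\<not> ?thesis"
      then obtain K L where "K \<in> \<C>" "F \<notin> K" "L \<in> \<C>" "G \<notin> L" by blast
      \<comment> \<open>M is the smaller of K and L.\<close>
      with total obtain M where M: "M \<in> \<C>" "F \<notin> M" "G \<notin> M" by blast
      with FG have "F \<oplus>\<^sub>s G \<in> M" by blast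
      with M uc[OF M(1)] show False unfolding ultracontact_def by blast
    qed
  qed
qed

text \<open>The meet is a chosen greatest lower bound, so \<open>UC_complete_lattice\<close> is what
  guarantees that the choice really is one; antisymmetry of inclusion then identifies it with the
  intersection.\<close>

lemma UC_meet_eq_Inter:
  assumes A: "\<And>K. K \<in> A \<Longrightarrow> ultracontact K" and I: "ultracontact (\<Inter>A)"
  shows "\<Sqinter>\<^bsub>UC\<^esub> A = \<Inter>A"
proof -
  interpret complete_lattice UC by (rule UC_complete_lattice)
  have AC: "A \<subseteq> carrier UC" using A by (auto simp: UC_def)
  have "is_glb UC (\<Inter>A) A"
    using AC I by (intro greatest_LowerI) (auto simp: UC_def Lower_def)
  moreover have "is_glb UC (\<Sqinter>\<^bsub>UC\<^esub> A) A"
    using AC by (rule inf_glb)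
  ultimately show ?thesis using greatest_unique by metis
qed

theorem theorem4p9:
  fixes \<C> :: "'a::boolean_algebra set set set"
  assumes nontrivial: "(bot :: 'a) \<noteq> Orderings.top"
    and nonempty: "\<C> \<noteq> {}"
    and chain: "subset.chain {K. ultracontact K} \<C>"
  shows "ultracontact (\<Inter>\<C>) \<and> \<Sqinter>\<^bsub>UC\<^esub> \<C> = \<Inter>\<C>"
proof -
  have "ultracontact (\<Inter>\<C>)"
    using nonempty chain by (rule ultracontact_Inter_chain)
  moreover have "\<And>K. K \<in> \<C> \<Longrightarrow> ultracontact K"
    using chain unfolding subset_chain_def by blast
  ultimately show ?thesis by (simp add: UC_meet_eq_Inter)
qed

end
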